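(* As $k\to\infty$, $$1-16k^{-1}-o(k^{-1})\le d(k,\mathbb{Z}^2)\le 1-8k^{-1}+o(k^{-1}).$$ That is, there are real-valued functions $f,g$ of the integer $k\geq 3$ with $k f(k)\to 0$ and $k g(k)\to 0$ as $k\to\infty$ such that $1-\frac{16}{k}-f(k)\le d(k,\mathbb{Z}^2)\le 1-\frac{8}{k}+g(k)$ for all sufficiently large $k$.
   Context: Notation: $\mathbb{N}=\{1,2,3,\dots\}$, $[n]=\{1,\dots,n\}$. Let $k\ge 3$ be an integer. For $m,n\in\mathbb{N}$, the board $B=[m]\times[n]\subseteq\mathbb{Z}^2$ has as its $k$-lines all sets $\{p+j\vec d: 0\le j\le k-1\}$ with $p\in B$ and $\vec d\in\{-1,0,1\}^2\setminus\{0\}$ that are contained in $B$. A configuration of $B$ is a subset $S\subseteq B$ with $|L\setminus S|\ge 2$ for every $k$-line $L$ of $B$. A saturated configuration is a configuration that is maximal with respect to inclusion among configurations; $\mathcal{S}_k(B)$ is the set of saturated configurations. Define $d(k,B)=\min_{S\in\mathcal{S}_k(B)}|S|/|B|$. Finally $d(k,\mathbb{Z}^2)=\lim_{t\to\infty}d(k,[m(t)]\times[n(t)])$, where $m,n:\mathbb{N}\to\mathbb{N}$ are arbitrary maps with $m(t),n(t)\to\infty$; this limit exists and does not depend on the choice of $m,n$ (in particular one may take $m(t)=n(t)=t$). *)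

theory Defs
  imports "HOL-Analysis.Analysis"
begin

definition board :: "nat \<Rightarrow> nat \<Rightarrow> (int \<times> int) set" where
  "board m n = {1..int m} \<times> {1..int n}"

definition directions :: "(int \<times> int) set" where
  "directions = {-1, 0, 1} \<times> {-1, 0, 1} - {(0, 0)}"

definition segment :: "nat \<Rightarrow> int \<times> int \<Rightarrow> int \<times> int \<Rightarrow> (int \<times> int) set" where
  "segment k p d = (\<lambda>j. (fst p + int j * fst d, snd p + int j * snd d)) ` {..<k}"

definition k_lines :: "nat \<Rightarrow> (int \<times> int) set \<Rightarrow> (int \<times> int) set set" where
  "k_lines k B = {segment k p d | p d. p \<in> B \<and> d \<in> directions \<and> segment k p d \<subseteq> B}"

definition configuration :: "nat \<Rightarrow> (int \<times> int) set \<Rightarrow> (int \<times> int) set \<Rightarrow> bool" where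
  "configuration k B S \<longleftrightarrow> S \<subseteq> B \<and> (\<forall>L\<in>k_lines k B. card (L - S) \<ge> 2)"

definition saturated :: "nat \<Rightarrow> (int \<times> int) set \<Rightarrow> (int \<times> int) set set" where
  "saturated k B =
    {S. configuration k B S \<and> (\<forall>T. configuration k B T \<and> S \<subseteq> T \<longrightarrow> T = S)}"

definition min_density :: "nat \<Rightarrow> (int \<times> int) set \<Rightarrow> real" where
  "min_density k B = Min ((\<lambda>S. real (card S) / real (card B)) ` saturated k B)"

text \<open>The common limit of \<^term>\<open>min_density k (board (m t) (n t))\<close> over all pairs of
  sequences \<open>m\<close>, \<open>n\<close> tending to infinity. Sequences are indexed from 0 and may take the value 0
  at finitely many places, which does not affect the limit. At most one real number satisfies
  the description; that one exists is not built into the definition.\<close>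

definition plane_density :: "nat \<Rightarrow> real" where
  "plane_density k = (THE l. \<forall>m n :: nat \<Rightarrow> nat.
     filterlim m at_top sequentially \<longrightarrow> filterlim n at_top sequentially \<longrightarrow>
     (\<lambda>t. min_density k (board (m t) (n t))) \<longlonglongrightarrow> l)"

end

theory Submission
  imports Defs "HOL-Real_Asymp.Real_Asymp"
begin

text \<open>
  Everything is expressed through the holes \<open>H = B - S\<close> of a configuration \<open>S\<close>. A configuration
  is one whose holes meet every \<open>k\<close>-line at least twice, and it is saturated iff each hole is
  \<^emph>\<open>pinned\<close>: it lies on a \<open>k\<close>-line with exactly two holes, so that filling it would spoil that line.
  Minimising \<open>card S\<close> means packing in as many pinned holes as possible, and the theorem says that
  their largest possible density is between \<open>8 / k\<close>, asymptotically, and \<open>16 / k\<close>.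

  \<^emph>\<open>The limit.\<close> Pinned holes stay holes when a configuration is enlarged to a saturated one
  (\<open>pinned_survives\<close>), so any pattern of holes on a board yields a saturated configuration with at
  least as many holes as the pattern has pinned ones. Restricting a periodic pattern of the plane to
  a large board therefore bounds the minimal density from above
  (\<open>min_density_le_pattern\<close>). Conversely, a saturated configuration of an \<open>m\<close> by \<open>n\<close> board, erased
  in a frame of width \<open>k\<close> along its boundary and then repeated periodically, is a periodic pattern
  that keeps pinned all but \<open>4 k (m + n)\<close> of the holes (\<open>periodise_saturated\<close>). Hence the densities
  of boards converge to one minus the supremum of the pinned densities of periodic patterns
  (\<open>plane_density_eq\<close>).

  \<^emph>\<open>At most \<open>16 / k\<close>.\<close> Among \<open>k\<close> consecutive cells of a line, at most four holes are pinned
  along that line: a pinning window that meets the \<open>k\<close> cells contains the first or the last of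
  them, and the windows at either end jointly account for at most two holes
  (\<open>card_window_critical\<close>). There are four directions.

  \<^emph>\<open>At least \<open>8 / k\<close>.\<close> Take pairs of adjacent full rows and pairs of adjacent full columns,
  repeated with period \<open>D\<close> close to \<open>k / 2\<close>. A hole in one of the rows and in none of the columns
  is pinned vertically, and symmetrically. Rows and columns contribute density \<open>2 / D\<close> each, up to
  crossings of density \<open>O(1 / k\<^sup>2)\<close>, which makes \<open>8 / k\<close> in total (\<open>pattern_densities_grid\<close>).
\<close>

section \<open>Holes and pinned holes\<close>

text \<open>Boards and the whole plane are both needed as \<open>B\<close>; segments inside \<open>B\<close> are exactly its
  \<open>k\<close>-lines.\<close>

definition design :: "nat \<Rightarrow> (int \<times> int) set \<Rightarrow> (int \<times> int) set \<Rightarrow> bool" where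
  "design k B H \<longleftrightarrow>
    (\<forall>p. \<forall>d\<in>directions. segment k p d \<subseteq> B \<longrightarrow> 2 \<le> card (segment k p d \<inter> H))"

definition pinned :: "nat \<Rightarrow> (int \<times> int) set \<Rightarrow> (int \<times> int) set \<Rightarrow> (int \<times> int) set" where
  "pinned k B H =
    {h \<in> H. \<exists>p. \<exists>d\<in>directions.
       segment k p d \<subseteq> B \<and> h \<in> segment k p d \<and> card (segment k p d \<inter> H) = 2}"

lemma pinnedI:
  assumes "h \<in> H" "d \<in> directions" "segment k p d \<subseteq> B" "h \<in> segment k p d"
    "card (segment k p d \<inter> H) = 2"
  shows "h \<in> pinned k B H"
  using assms unfolding pinned_def by blast

lemma mem_segment:
  "q \<in> segment k p d \<longleftrightarrow>
    (\<exists>j<k. q = (fst p + int j * fst d, snd p + int j * snd d))"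
  by (auto simp: segment_def)

lemma finite_segment [simp]: "finite (segment k p d)"
  by (simp add: segment_def)

lemma start_in_segment: "0 < k \<Longrightarrow> p \<in> segment k p d"
  by (auto simp: mem_segment intro!: exI[of _ 0])

lemma directions_cases:
  "d \<in> directions \<longleftrightarrow>
    d \<in> {(1,0), (1,1), (1,-1), (0,1), (-1,0), (-1,-1), (-1,1), (0,-1)}"
  by (cases d) (auto simp: directions_def)

lemma card_segment:
  assumes "d \<in> directions"
  shows "card (segment k p d) = k"
proof -
  have "inj_on (\<lambda>j. (fst p + int j * fst d, snd p + int j * snd d)) {..<k}"
    using assms by (auto simp: inj_on_def directions_def)
  then show ?thesis
    by (simp add: segment_def card_image)
qed

lemma segment_near:
  assumes "q \<in> segment k p d" "r \<in> segment k p d" "d \<in> directions"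
  shows "\<bar>fst q - fst r\<bar> < int k" "\<bar>snd q - snd r\<bar> < int k"
  using assms by (auto simp: mem_segment directions_cases)

lemma segment_translate:
  "segment k (p + v) d = (\<lambda>z. z + v) ` segment k p d"
  unfolding segment_def image_image by (intro image_cong) (auto simp: prod_eq_iff)

lemma segment_reverse:
  assumes "0 < k"
  shows "segment k p d =
    segment k (fst p + (int k - 1) * fst d, snd p + (int k - 1) * snd d) (- d)"
    (is "?L = ?R")
proof (intro equalityI subsetI)
  fix q assume "q \<in> ?L"
  then obtain j where "j < k" "q = (fst p + int j * fst d, snd p + int j * snd d)"
    by (auto simp: mem_segment)
  then show "q \<in> ?R"
    unfolding mem_segment by (intro exI[of _ "k - 1 - j"]) (auto simp: algebra_simps of_nat_diff)
next
  fix q assume "q \<in> ?R"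
  then obtain j where "j < k"
    "q = (fst p + (int k - 1) * fst d - int j * fst d, snd p + (int k - 1) * snd d - int j * snd d)"
    by (auto simp: mem_segment)
  then show "q \<in> ?L"
    unfolding mem_segment by (intro exI[of _ "k - 1 - j"]) (auto simp: algebra_simps of_nat_diff)
qed

lemma k_lines_iff:
  "0 < k \<Longrightarrow> L \<in> k_lines k B \<longleftrightarrow>
    (\<exists>p. \<exists>d\<in>directions. L = segment k p d \<and> segment k p d \<subseteq> B)"
  unfolding k_lines_def using start_in_segment by blast

lemma configuration_iff_design:
  assumes "0 < k"
  shows "configuration k B S \<longleftrightarrow> S \<subseteq> B \<and> design k B (B - S)"
proof -
  have "segment k p d - S = segment k p d \<inter> (B - S)" if "segment k p d \<subseteq> B" for p d
    using that by blast
  then show ?thesis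
    unfolding configuration_def design_def Ball_def k_lines_iff[OF assms] by metis
qed

lemma finite_board [simp]: "finite (board m n)"
  by (simp add: board_def)

lemma card_board: "card (board m n) = m * n"
  by (simp add: board_def card_cartesian_product)

lemma configuration_empty:
  assumes "2 \<le> k"
  shows "configuration k B {}"
  using assms card_segment by (auto simp: configuration_def k_lines_def)

lemma configuration_extends:
  assumes "finite B" "configuration k B S"
  obtains T where "T \<in> saturated k B" "S \<subseteq> T"
proof -
  let ?C = "{T. configuration k B T}"
  have "finite ?C"
    by (rule finite_subset[of _ "Pow B"]) (use assms in \<open>auto simp: configuration_def\<close>)
  then obtain T where "T \<in> ?C" "S \<subseteq> T" "\<And>U. U \<in> ?C \<Longrightarrow> T \<subseteq> U \<Longrightarrow> T = U"
    using finite_has_maximal2[of ?C S] assms(2) by auto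
  then have "T \<in> saturated k B"
    by (auto simp: saturated_def)
  with \<open>S \<subseteq> T\<close> that show thesis by blast
qed

text \<open>The witnessing line has only two holes in \<open>S\<close>, and the larger configuration \<open>T\<close> still needs
  two holes on it, so \<open>T\<close> cannot fill either of them.\<close>

lemma pinned_survives:
  assumes "0 < k" "configuration k B T" "S \<subseteq> T" "h \<in> pinned k B (B - S)"
  shows "h \<notin> T"
proof -
  obtain p d where L: "d \<in> directions" "segment k p d \<subseteq> B" "h \<in> segment k p d"
      "card (segment k p d \<inter> (B - S)) = 2" and h: "h \<in> B - S"
    using assms(4) by (auto simp: pinned_def)
  have "2 \<le> card (segment k p d \<inter> (B - T))"
    using assms(1,2) L unfolding configuration_iff_design[OF assms(1)] design_def by blast
  moreover have "segment k p d \<inter> (B - T) \<subseteq> segment k p d \<inter> (B - S)"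
    using assms(3) by blast
  ultimately have "segment k p d \<inter> (B - T) = segment k p d \<inter> (B - S)"
    using L(4) by (intro card_seteq) (simp_all del: Int_subset_iff)
  with L(3) h show ?thesis by blast
qed

text \<open>By maximality, filling a hole \<open>h\<close> breaks some line. That line must pass through \<open>h\<close> and lose its
  second hole, so it had exactly two.\<close>

lemma saturated_holes_pinned:
  assumes "0 < k" "S \<in> saturated k B"
  shows "pinned k B (B - S) = B - S"
proof
  show "pinned k B (B - S) \<subseteq> B - S"
    by (auto simp: pinned_def)
  show "B - S \<subseteq> pinned k B (B - S)"
  proof
    fix h assume h: "h \<in> B - S"
    have conf: "configuration k B S"
      and max: "\<And>T. configuration k B T \<Longrightarrow> S \<subseteq> T \<Longrightarrow> T = S"
      using assms(2) by (auto simp: saturated_def)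
    have "\<not> configuration k B (insert h S)"
      using max[of "insert h S"] h by blast
    then obtain p d where L: "d \<in> directions" "segment k p d \<subseteq> B"
      "\<not> 2 \<le> card (segment k p d \<inter> (B - insert h S))"
      using conf h unfolding configuration_iff_design[OF assms(1)] design_def by auto
    have ge: "2 \<le> card (segment k p d \<inter> (B - S))"
      using conf L(1,2) unfolding configuration_iff_design[OF assms(1)] design_def by blast
    have eq: "segment k p d \<inter> (B - insert h S) = segment k p d \<inter> (B - S) - {h}"
      by blast
    have hL: "h \<in> segment k p d"
    proof (rule ccontr)
      assume "h \<notin> segment k p d"
      then have "segment k p d \<inter> (B - S) - {h} = segment k p d \<inter> (B - S)" by blast
      with L(3) ge eq show False by simp
    qed
    then have "card (segment k p d \<inter> (B - S)) = 2"
      using L(3) ge h unfolding eq by simp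
    with L hL h show "h \<in> pinned k B (B - S)"
      by (intro pinnedI) auto
  qed
qed

lemma finite_saturated: "finite B \<Longrightarrow> finite (saturated k B)"
  by (rule finite_subset[of _ "Pow B"]) (auto simp: saturated_def configuration_def)

lemma min_density_le_pinned:
  assumes "0 < k" "0 < m" "0 < n" "design k (board m n) H" "H \<subseteq> board m n"
  shows "min_density k (board m n) \<le> 1 - real (card (pinned k (board m n) H)) / (real m * real n)"
proof -
  let ?B = "board m n" and ?G = "pinned k (board m n) H"
  have H: "?B - (?B - H) = H"
    using assms(5) by blast
  have "configuration k ?B (?B - H)"
    using assms by (auto simp: configuration_iff_design H)
  then obtain T where T: "T \<in> saturated k ?B" "?B - H \<subseteq> T"
    using configuration_extends[OF finite_board] by blast
  then have conf: "configuration k ?B T"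
    by (auto simp: saturated_def)
  then have "T \<subseteq> ?B - ?G"
    using pinned_survives[OF assms(1) conf T(2)] unfolding H by (auto simp: configuration_def)
  moreover have sub: "?G \<subseteq> ?B"
    using assms(5) by (auto simp: pinned_def)
  ultimately have "card T \<le> m * n - card ?G"
    by (metis card_Diff_subset card_board card_mono finite_Diff finite_board finite_subset)
  moreover have "card ?G \<le> m * n"
    using sub by (metis card_board card_mono finite_board)
  ultimately have "real (card T) \<le> real m * real n - real (card ?G)"
    by (simp add: of_nat_diff flip: of_nat_mult)
  then have "real (card T) / (real m * real n) \<le> 1 - real (card ?G) / (real m * real n)"
    using assms by (simp add: field_simps)
  moreover have "min_density k ?B \<le> real (card T) / real (card ?B)"
    unfolding min_density_def using T(1) by (intro Min_le) (auto simp: finite_saturated)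
  ultimately show ?thesis
    by (simp add: card_board)
qed

lemma min_density_attained:
  assumes "2 \<le> k" "0 < m" "0 < n"
  obtains S where "S \<in> saturated k (board m n)"
    "min_density k (board m n) = 1 - real (card (board m n - S)) / (real m * real n)"
proof -
  let ?B = "board m n"
  have "saturated k ?B \<noteq> {}"
    using configuration_extends[OF finite_board configuration_empty[OF assms(1)]] by blast
  then have "min_density k ?B \<in> (\<lambda>S. real (card S) / real (card ?B)) ` saturated k ?B"
    unfolding min_density_def by (intro Min_in) (auto simp: finite_saturated)
  then obtain S where S: "S \<in> saturated k ?B" "min_density k ?B = real (card S) / real (card ?B)"
    by blast
  have sub: "S \<subseteq> ?B"
    using S by (auto simp: saturated_def configuration_def)
  then have "card S \<le> card ?B" "card (?B - S) = card ?B - card S"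
    by (auto intro: card_mono card_Diff_subset[OF finite_subset[OF _ finite_board]])
  then have "real (card S) = real m * real n - real (card (?B - S))"
    by (simp add: of_nat_diff card_board)
  then have "real (card S) / (real m * real n) = 1 - real (card (?B - S)) / (real m * real n)"
    using assms by (simp add: field_simps)
  with S that show thesis
    by (simp add: card_board)
qed

section \<open>At most sixteen holes per \<open>k\<close> cells\<close>

text \<open>The one-dimensional core of the upper bound on holes. A window of length \<open>k\<close> that contains a
  point of the block \<open>{a..<a + k}\<close> starts either at or before \<open>a\<close>, and then covers an initial part
  of the block, or at or after \<open>a\<close>, and then covers a final part. Among the windows of the first
  kind, the one belonging to the rightmost point covers all the points of that kind; likewise on the
  other side. Each of these two windows contains at most two points of \<open>X\<close>.\<close>

lemma card_window_critical:
  fixes X J :: "int set" and k :: nat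
  assumes J: "J \<subseteq> X \<inter> {a..<a + int k}"
    and crit: "\<And>j. j \<in> J \<Longrightarrow> \<exists>s. s \<le> j \<and> j < s + int k \<and> card (X \<inter> {s..<s + int k}) \<le> 2"
  shows "card J \<le> 4"
proof -
  obtain s where s: "\<And>j. j \<in> J \<Longrightarrow> s j \<le> j \<and> j < s j + int k \<and> card (X \<inter> {s j..<s j + int k}) \<le> 2"
    using crit by metis
  have finJ: "finite J"
    using J finite_subset by blast
  define J1 J2 where "J1 = {j \<in> J. s j \<le> a}" and "J2 = {j \<in> J. a \<le> s j}"
  have *: "card I \<le> 2" if "j \<in> J" "I \<subseteq> X \<inter> {s j..<s j + int k}" for I j
    using card_mono[OF _ that(2)] s[OF that(1)] by auto
  have "card J1 \<le> 2"
  proof (cases "J1 = {}")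
    case False
    have fin: "finite J1" using finJ by (simp add: J1_def)
    then have "Max J1 \<in> J1" using False by simp
    then have m: "Max J1 \<in> J" "s (Max J1) \<le> a" by (auto simp: J1_def)
    have "J1 \<subseteq> X \<inter> {s (Max J1)..<s (Max J1) + int k}"
    proof
      fix j assume j: "j \<in> J1"
      then have "j \<le> Max J1" "j \<in> J" using fin by (auto simp: J1_def)
      then show "j \<in> X \<inter> {s (Max J1)..<s (Max J1) + int k}"
        using J m s[OF m(1)] by fastforce
    qed
    then show ?thesis by (rule *[OF m(1)])
  qed auto
  moreover have "card J2 \<le> 2"
  proof (cases "J2 = {}")
    case False
    have fin: "finite J2" using finJ by (simp add: J2_def)
    then have "Min J2 \<in> J2" using False by simp
    then have m: "Min J2 \<in> J" "a \<le> s (Min J2)" by (auto simp: J2_def)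
    have "J2 \<subseteq> X \<inter> {s (Min J2)..<s (Min J2) + int k}"
    proof
      fix j assume j: "j \<in> J2"
      then have "Min J2 \<le> j" "j \<in> J" using fin by (auto simp: J2_def)
      then show "j \<in> X \<inter> {s (Min J2)..<s (Min J2) + int k}"
        using J m s[OF m(1)] by fastforce
    qed
    then show ?thesis by (rule *[OF m(1)])
  qed auto
  moreover have "J = J1 \<union> J2" by (auto simp: J1_def J2_def)
  ultimately show ?thesis
    using card_Un_le[of J1 J2] by simp
qed

definition pinned_along :: "nat \<Rightarrow> (int \<times> int) set \<Rightarrow> int \<times> int \<Rightarrow> (int \<times> int) set" where
  "pinned_along k H d = {h \<in> H. \<exists>p. h \<in> segment k p d \<and> card (segment k p d \<inter> H) \<le> 2}"

lemma card_le_fibres: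
  assumes "finite A" "finite K" "f ` A \<subseteq> K" "\<And>y. y \<in> K \<Longrightarrow> card {x \<in> A. f x = y} \<le> c"
  shows "card A \<le> c * card K"
proof -
  have "card A = (\<Sum>y\<in>K. card {x \<in> A. f x = y})"
    using sum.group[OF assms(1-3), of "\<lambda>_. 1::nat"] by simp
  also have "\<dots> \<le> (\<Sum>y\<in>K. c)"
    by (intro sum_mono assms(4))
  finally show ?thesis by (simp add: mult.commute)
qed

text \<open>The plane is cut into vertical strips of width \<open>k\<close>. Each line of direction \<open>(1, e)\<close> meets a strip
  in \<open>k\<close> consecutive points, to which the previous count applies. A pair (strip, line) is encoded by
  the index of the strip and the height at which the line enters it; a point of the board is at most
  \<open>k\<close> above or below this entry, which leaves at most \<open>n + 2 k\<close> heights.\<close>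

lemma card_pinned_along:
  assumes k: "0 < k" and H: "H \<subseteq> board m n" and e: "\<bar>e\<bar> \<le> 1"
  shows "card (pinned_along k H (1, e)) \<le> 4 * ((m div k + 1) * (n + 2 * k))"
proof -
  define A where "A = pinned_along k H (1, e)"
  define f where "f = (\<lambda>(x::int, y::int). ((x - 1) div int k, y - e * ((x - 1) mod int k)))"
  define K where "K = {0..int (m div k)} \<times> {1 - int k..int n + int k}"
  have AH: "A \<subseteq> H" by (auto simp: A_def pinned_along_def)
  have finA: "finite A"
    using AH H finite_board finite_subset by metis
  have "f ` A \<subseteq> K"
  proof
    fix z assume "z \<in> f ` A"
    then obtain x y where xy: "z = f (x, y)" "(x, y) \<in> board m n"
      using AH H by auto
    have "0 \<le> (x - 1) mod int k" "(x - 1) mod int k < int k"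
      using k by auto
    moreover have "e = -1 \<or> e = 0 \<or> e = 1" using e by auto
    ultimately have "\<bar>e * ((x - 1) mod int k)\<bar> < int k" by auto
    moreover have "(x - 1) div int k \<le> int m div int k"
      using xy k by (intro zdiv_mono1) (auto simp: board_def)
    moreover have "0 \<le> (x - 1) div int k"
      using xy k by (auto simp: board_def pos_imp_zdiv_nonneg_iff)
    ultimately show "z \<in> K"
      using xy by (auto simp: K_def f_def board_def zdiv_int)
  qed
  moreover have "card {q \<in> A. f q = z} \<le> 4" for z
  proof -
    obtain b c where z: "z = (b, c)" by force
    define pt where "pt = (\<lambda>t. (b * int k + 1 + t, c + e * t))"
    define X where "X = {t. pt t \<in> H}"
    define J where "J = {t \<in> {0..<0 + int k}. pt t \<in> A}"
    have inj: "inj pt" by (auto simp: inj_def pt_def)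
    have "{q \<in> A. f q = z} = pt ` J"
    proof (intro equalityI subsetI)
      fix q assume "q \<in> {q \<in> A. f q = z}"
      then obtain x y where q: "q = (x, y)" "q \<in> A"
          "(x - 1) div int k = b" "y - e * ((x - 1) mod int k) = c"
        by (cases q) (auto simp: f_def z)
      have "b * int k + (x - 1) mod int k = x - 1"
        unfolding q(3)[symmetric] by simp
      then have "q = pt ((x - 1) mod int k)"
        using q by (auto simp: pt_def)
      then show "q \<in> pt ` J"
        using q k by (auto simp: J_def)
    next
      fix q assume "q \<in> pt ` J"
      then show "q \<in> {q \<in> A. f q = z}"
        by (auto simp: J_def f_def pt_def z)
    qed
    then have "card {q \<in> A. f q = z} = card J"
      using inj by (simp add: card_image inj_on_subset)
    also have "\<dots> \<le> 4"
    proof (rule card_window_critical)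
      show "J \<subseteq> X \<inter> {0..<0 + int k}"
        using AH by (auto simp: J_def X_def)
      fix j assume "j \<in> J"
      then have "pt j \<in> pinned_along k H (1, e)" by (auto simp: J_def A_def)
      then obtain p where p: "pt j \<in> segment k p (1, e)" "card (segment k p (1, e) \<inter> H) \<le> 2"
        by (auto simp: pinned_along_def)
      then obtain i where i: "i < k" "pt j = (fst p + int i, snd p + int i * e)"
        by (auto simp: mem_segment)
      have *: "segment k p (1, e) = pt ` {j - int i..<j - int i + int k}"
      proof (intro equalityI subsetI)
        fix q assume "q \<in> segment k p (1, e)"
        then obtain l where l: "l < k" "q = (fst p + int l, snd p + int l * e)"
          by (auto simp: mem_segment)
        then have "q = pt (j - int i + int l)"
          using i by (auto simp: pt_def algebra_simps)
        then show "q \<in> pt ` {j - int i..<j - int i + int k}" using l by auto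
      next
        fix q assume "q \<in> pt ` {j - int i..<j - int i + int k}"
        then obtain t where t: "j - int i \<le> t" "t < j - int i + int k" "q = pt t" by auto
        have "q = (fst p + int (nat (t - j + int i)), snd p + int (nat (t - j + int i)) * e)"
          using i t by (auto simp: pt_def algebra_simps)
        moreover have "nat (t - j + int i) < k" using t by auto
        ultimately show "q \<in> segment k p (1, e)" by (auto simp: mem_segment)
      qed
      have "segment k p (1, e) \<inter> H = pt ` (X \<inter> {j - int i..<j - int i + int k})"
        unfolding * X_def by blast
      then have "card (X \<inter> {j - int i..<j - int i + int k}) \<le> 2"
        using p(2) inj by (simp add: card_image inj_on_subset)
      then show "\<exists>s\<le>j. j < s + int k \<and> card (X \<inter> {s..<s + int k}) \<le> 2"
        using i by (intro exI[of _ "j - int i"]) auto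
    qed
    finally show ?thesis .
  qed
  ultimately have "card A \<le> 4 * card K"
    by (intro card_le_fibres[OF finA]) (auto simp: K_def)
  also have "card K = (m div k + 1) * (n + 2 * k)"
    by (simp add: K_def card_cartesian_product nat_add_distrib nat_mult_distrib)
  finally show ?thesis by (simp add: A_def)
qed

lemma pinned_along_swap:
  "prod.swap ` pinned_along k H (0, 1) \<subseteq> pinned_along k (prod.swap ` H) (1, 0)"
proof
  fix z assume "z \<in> prod.swap ` pinned_along k H (0, 1)"
  then obtain h p where h: "z = prod.swap h" "h \<in> H" "h \<in> segment k p (0, 1)"
      "card (segment k p (0, 1) \<inter> H) \<le> 2"
    by (auto simp: pinned_along_def)
  have *: "segment k (prod.swap p) (1, 0) = prod.swap ` segment k p (0, 1)"
    by (simp add: segment_def image_image)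
  have "segment k (prod.swap p) (1, 0) \<inter> prod.swap ` H = prod.swap ` (segment k p (0, 1) \<inter> H)"
    unfolding * by (simp add: image_Int)
  then have "card (segment k (prod.swap p) (1, 0) \<inter> prod.swap ` H) \<le> 2"
    using h(4) by (simp add: card_image)
  moreover have "z \<in> segment k (prod.swap p) (1, 0)"
    unfolding * using h by blast
  ultimately show "z \<in> pinned_along k (prod.swap ` H) (1, 0)"
    using h unfolding pinned_along_def by blast
qed

text \<open>Opposite directions give the same lines, so four directions suffice. Three of them advance in the
  first coordinate; the vertical one is reduced to the horizontal one by transposing the board.\<close>

lemma card_saturated_holes:
  assumes k: "0 < k" and S: "S \<in> saturated k (board m n)"
  shows "card (board m n - S) \<le>
    12 * ((m div k + 1) * (n + 2 * k)) + 4 * ((n div k + 1) * (m + 2 * k))"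
proof -
  define H where "H = board m n - S"
  have Hb: "H \<subseteq> board m n" by (auto simp: H_def)
  have finH: "finite H" by (simp add: H_def)
  let ?A = "pinned_along k H"
  have fin: "finite (?A d)" for d
    by (rule finite_subset[OF _ finH]) (auto simp: pinned_along_def)
  have "H \<subseteq> ?A (1, 0) \<union> ?A (1, 1) \<union> ?A (1, -1) \<union> ?A (0, 1)"
  proof
    fix h assume "h \<in> H"
    then have "h \<in> pinned k (board m n) H"
      using saturated_holes_pinned[OF assms] by (simp add: H_def)
    then obtain p d where h: "h \<in> H" "d \<in> directions" "h \<in> segment k p d"
        "card (segment k p d \<inter> H) = 2"
      by (auto simp: pinned_def)
    have "h \<in> ?A d"
      using h by (auto simp: pinned_along_def simp del: split_paired_Ex)
    moreover have "h \<in> ?A (- d)"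
      using h segment_reverse[OF k, of p d] by (auto simp: pinned_along_def simp del: split_paired_Ex)
    ultimately show "h \<in> ?A (1, 0) \<union> ?A (1, 1) \<union> ?A (1, -1) \<union> ?A (0, 1)"
      using h(2) by (auto simp: directions_cases)
  qed
  then have "card H \<le> card (?A (1, 0) \<union> ?A (1, 1) \<union> ?A (1, -1) \<union> ?A (0, 1))"
    by (intro card_mono) (auto simp: fin)
  also have "\<dots> \<le> card (?A (1, 0)) + card (?A (1, 1)) + card (?A (1, -1)) + card (?A (0, 1))"
    by (meson add_mono card_Un_le le_refl order_trans)
  finally have "card H \<le> \<dots>" .
  moreover have "card (?A (1, 0)) \<le> 4 * ((m div k + 1) * (n + 2 * k))"
    "card (?A (1, 1)) \<le> 4 * ((m div k + 1) * (n + 2 * k))"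
    "card (?A (1, -1)) \<le> 4 * ((m div k + 1) * (n + 2 * k))"
    by (rule card_pinned_along[OF k Hb]; simp)+
  moreover have "card (?A (0, 1)) \<le> 4 * ((n div k + 1) * (m + 2 * k))"
  proof -
    have "card (?A (0, 1)) = card (prod.swap ` ?A (0, 1))"
      by (simp add: card_image)
    also have "\<dots> \<le> card (pinned_along k (prod.swap ` H) (1, 0))"
      by (rule card_mono[OF _ pinned_along_swap])
         (rule finite_subset[of _ "prod.swap ` H"], auto simp: pinned_along_def finH)
    also have "\<dots> \<le> 4 * ((n div k + 1) * (m + 2 * k))"
      by (rule card_pinned_along[OF k]) (use Hb in \<open>auto simp: board_def\<close>)
    finally show ?thesis .
  qed
  ultimately show ?thesis by (simp add: H_def)
qed

section \<open>The limit density\<close>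

definition periodic :: "nat \<Rightarrow> nat \<Rightarrow> (int \<times> int) set \<Rightarrow> bool" where
  "periodic m n H \<longleftrightarrow> (\<forall>i j z. z + (i * int m, j * int n) \<in> H \<longleftrightarrow> z \<in> H)"

definition pattern_densities :: "nat \<Rightarrow> real set" where
  "pattern_densities k =
    {real (card (pinned k UNIV H \<inter> board m n)) / (real m * real n) | m n H.
      0 < m \<and> 0 < n \<and> periodic m n H \<and> design k UNIV H}"

lemma periodic_pinned:
  assumes "periodic m n H" "h \<in> pinned k UNIV H"
  shows "h + (i * int m, j * int n) \<in> pinned k UNIV H"
proof -
  define v where "v = (i * int m, j * int n)"
  have v: "z + v \<in> H \<longleftrightarrow> z \<in> H" for z
    using assms(1) unfolding periodic_def v_def by blast
  obtain p d where h: "h \<in> H" "d \<in> directions" "h \<in> segment k p d"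
      "card (segment k p d \<inter> H) = 2"
    using assms(2) by (auto simp: pinned_def)
  have "segment k (p + v) d \<inter> H = (\<lambda>z. z + v) ` (segment k p d \<inter> H)"
    unfolding segment_translate using v by blast
  then have "card (segment k (p + v) d \<inter> H) = 2"
    using h(4) by (simp add: card_image)
  moreover have "h + v \<in> segment k (p + v) d"
    unfolding segment_translate using h by blast
  ultimately have "h + v \<in> pinned k UNIV H"
    using h v unfolding pinned_def by blast
  then show ?thesis by (simp add: v_def)
qed

text \<open>Copies with index from \<open>k\<close> up to \<open>M div m - k\<close> stay at distance at least \<open>k\<close> from the border,
  because the period is at least one.\<close>

lemma cell_inside:
  fixes k i m M :: nat
  assumes "0 < m" "k \<le> i" "i < M div m - k"
  shows "int k \<le> int i * int m" "int i * int m + int m + int k \<le> int M"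
proof -
  have "k * 1 \<le> i * m" using assms by (intro mult_le_mono) auto
  then show "int k \<le> int i * int m" by (simp flip: of_nat_mult)
  have "(i + 1 + k) * m \<le> (M div m) * m" using assms by (intro mult_le_mono) auto
  also have "\<dots> \<le> M" by simp
  finally have "(i + 1 + k) * m \<le> M" .
  moreover have "k * 1 \<le> k * m" using assms by (intro mult_le_mono) auto
  moreover have "(i + 1 + k) * m = i * m + m + k * m" by (simp add: algebra_simps)
  ultimately have "i * m + m + k \<le> M" by linarith
  then show "int i * int m + int m + int k \<le> int M"
    by (simp flip: of_nat_mult of_nat_add)
qed

lemma offset_cancel:
  fixes x x' :: int
  assumes "x + int i * int m = x' + int i' * int m" "1 \<le> x" "x \<le> int m" "1 \<le> x'" "x' \<le> int m"
  shows "i = i'"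
proof -
  have "(x - 1 + int i * int m) div int m = int i" "(x' - 1 + int i' * int m) div int m = int i'"
    using assms by auto
  moreover have "x - 1 + int i * int m = x' - 1 + int i' * int m"
    using assms(1) by simp
  ultimately show ?thesis by simp
qed

text \<open>Every pinned hole of a cell is copied into each period cell whose distance to the border of the
  board is at least \<open>k\<close>; there the line that pins it lies inside the board.\<close>

lemma card_pinned_board:
  assumes "0 < m" "0 < n" "periodic m n H"
  shows "(M div m - 2 * k) * (N div n - 2 * k) * card (pinned k UNIV H \<inter> board m n)
    \<le> card (pinned k (board M N) (H \<inter> board M N))"
proof -
  let ?B = "board M N" and ?G = "pinned k UNIV H"
  define I where "I = ({k..<M div m - k} \<times> {k..<N div n - k}) \<times> (?G \<inter> board m n)"
  define f where "f = (\<lambda>((i, j), p). p + (int i * int m, int j * int n))"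
  have inj: "inj_on f I"
  proof (rule inj_onI)
    fix a b assume ab: "a \<in> I" "b \<in> I" "f a = f b"
    obtain i j x y where a: "a = ((i, j), (x, y))" by (metis surj_pair)
    obtain i' j' x' y' where b: "b = ((i', j'), (x', y'))" by (metis surj_pair)
    have *: "1 \<le> x" "x \<le> int m" "1 \<le> x'" "x' \<le> int m" "1 \<le> y" "y \<le> int n" "1 \<le> y'" "y' \<le> int n"
      "x + int i * int m = x' + int i' * int m" "y + int j * int n = y' + int j' * int n"
      using ab by (auto simp: a b I_def f_def board_def)
    then have "i = i'" "j = j'"
      by (auto intro: offset_cancel)
    with * show "a = b" by (simp add: a b)
  qed
  have "f ` I \<subseteq> pinned k ?B (H \<inter> ?B)"
  proof
    fix q assume "q \<in> f ` I"
    then obtain i j x y where q: "q = (x, y) + (int i * int m, int j * int n)"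
      "(x, y) \<in> ?G" "(x, y) \<in> board m n" "k \<le> i" "i < M div m - k" "k \<le> j" "j < N div n - k"
      by (auto simp: I_def f_def)
    have "q \<in> ?G"
      unfolding q(1) by (rule periodic_pinned[OF assms(3) q(2)])
    then obtain p d where h: "q \<in> H" "d \<in> directions" "q \<in> segment k p d"
      "card (segment k p d \<inter> H) = 2"
      by (auto simp: pinned_def)
    have sub: "segment k p d \<subseteq> ?B"
    proof
      fix r assume r: "r \<in> segment k p d"
      show "r \<in> ?B"
        using segment_near[OF h(3) r h(2)] q(1,3) cell_inside[OF assms(1) q(4,5)]
          cell_inside[OF assms(2) q(6,7)]
        by (cases r) (auto simp: board_def)
    qed
    then have "segment k p d \<inter> (H \<inter> ?B) = segment k p d \<inter> H" by blast
    moreover have "q \<in> H \<inter> ?B" using h(1,3) sub by blast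
    ultimately show "q \<in> pinned k ?B (H \<inter> ?B)"
      using h(2-4) sub by (intro pinnedI) auto
  qed
  moreover have "finite (pinned k ?B (H \<inter> ?B))"
    by (rule finite_subset[OF _ finite_board]) (auto simp: pinned_def)
  ultimately have "card (f ` I) \<le> card (pinned k ?B (H \<inter> ?B))"
    by (intro card_mono)
  moreover have "card (f ` I) = (M div m - 2 * k) * (N div n - 2 * k) * card (?G \<inter> board m n)"
    using inj by (simp add: card_image I_def card_cartesian_product diff_diff_left mult_2)
  ultimately show ?thesis by simp
qed

text \<open>Side-by-side copies of a saturated configuration may violate the condition on lines that cross
  from one copy to the next. The part \<open>C\<close> of \<open>S\<close> at distance at least \<open>k\<close> from the border avoids
  this: a segment meeting a copy of \<open>C\<close> lies in a single copy of the board, and every other segment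
  consists of holes. A hole at distance \<open>2 k\<close> from the border is pinned by a line at distance at
  least \<open>k\<close>, on which nothing has been erased, so it remains pinned.\<close>

lemma periodise_saturated:
  assumes k: "2 \<le> k" and m: "0 < m" and n: "0 < n" and S: "S \<in> saturated k (board m n)"
  obtains H where "periodic m n H" "design k UNIV H"
    "card (board m n - S) \<le> card (pinned k UNIV H \<inter> board m n) + 4 * k * (m + n)"
proof -
  let ?B = "board m n"
  \<comment> \<open>the representative of a point in the fundamental cell \<open>board m n\<close>\<close>
  define red where "red = (\<lambda>(x, y). ((x - 1) mod int m + 1, (y - 1) mod int n + 1))"
  define inner where "inner = (\<lambda>r. {r + 1..int m - r} \<times> {r + 1..int n - r})"
  define C where "C = S \<inter> inner (int k)"
  define H where "H = {z. red z \<notin> C}"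
  have red_id: "red z = z" if "z \<in> ?B" for z
    using that by (auto simp: red_def board_def)
  have red_shift: "red (z + (i * int m, j * int n)) = red z" for z i j
  proof -
    have "(x + i * int m - 1) mod int m = (x - 1) mod int m"
      "(x + j * int n - 1) mod int n = (x - 1) mod int n" for x
      using mod_mult_self1[of "x - 1" i "int m"] mod_mult_self1[of "x - 1" j "int n"]
      by (simp_all add: algebra_simps)
    then show ?thesis by (cases z) (simp add: red_def)
  qed
  have red_offset: "\<exists>i j. z = red z + (i * int m, j * int n)" for z
    by (cases z, rule exI[of _ "(fst z - 1) div int m"], rule exI[of _ "(snd z - 1) div int n"])
       (simp add: red_def)
  have des: "design k ?B (?B - S)"
    using S k by (auto simp: saturated_def configuration_iff_design)
  have "periodic m n H"
    by (simp add: periodic_def H_def red_shift del: split_paired_All)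
  moreover have "design k UNIV H"
    unfolding design_def
  proof (intro allI ballI impI)
    fix p d assume d: "d \<in> directions"
    show "2 \<le> card (segment k p d \<inter> H)"
    proof (cases "segment k p d \<subseteq> H")
      case True
      then have "segment k p d \<inter> H = segment k p d" by blast
      then show ?thesis using k card_segment[OF d] by simp
    next
      case False
      then obtain q where q: "q \<in> segment k p d" "red q \<in> C" by (auto simp: H_def)
      obtain i j where "q = red q + (i * int m, j * int n)" using red_offset by blast
      define v where "v = (i * int m, j * int n)"
      define p' where "p' = p - v"
      have qv: "q = red q + v" using \<open>q = _\<close> by (simp add: v_def)
      have p: "segment k p d = (\<lambda>z. z + v) ` segment k p' d"
        using segment_translate[of k p' v d] by (simp add: p'_def)
      have rq: "red q \<in> segment k p' d"
      proof -
        have "red q + v \<in> (\<lambda>z. z + v) ` segment k p' d"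
          using q(1) qv p by simp
        then show ?thesis by auto
      qed
      have sub: "segment k p' d \<subseteq> ?B"
      proof
        fix r assume r: "r \<in> segment k p' d"
        show "r \<in> ?B"
          using segment_near[OF rq r d] q(2)
          by (cases r; cases "red q") (auto simp: board_def C_def inner_def)
      qed
      have "(\<lambda>z. z + v) ` (segment k p' d \<inter> (?B - S)) \<subseteq> segment k p d \<inter> H"
      proof
        fix z assume "z \<in> (\<lambda>z. z + v) ` (segment k p' d \<inter> (?B - S))"
        then obtain w where w: "z = w + v" "w \<in> segment k p' d" "w \<in> ?B" "w \<notin> S" by blast
        have "red z = w" using w red_shift red_id by (simp add: v_def)
        with w p show "z \<in> segment k p d \<inter> H" by (auto simp: H_def C_def)
      qed
      then have "card ((\<lambda>z. z + v) ` (segment k p' d \<inter> (?B - S))) \<le> card (segment k p d \<inter> H)"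
        by (intro card_mono) auto
      moreover have "2 \<le> card (segment k p' d \<inter> (?B - S))"
        using des d sub unfolding design_def by blast
      ultimately show ?thesis by (simp add: card_image)
    qed
  qed
  moreover have "card (?B - S) \<le> card (pinned k UNIV H \<inter> ?B) + 4 * k * (m + n)"
  proof -
    let ?E1 = "({1..2 * int k} \<union> {int m - 2 * int k + 1..int m}) \<times> {1..int n}"
    let ?E2 = "{1..int m} \<times> ({1..2 * int k} \<union> {int n - 2 * int k + 1..int n})"
    have "?B - S \<subseteq> (pinned k UNIV H \<inter> ?B) \<union> (?E1 \<union> ?E2)"
    proof
      fix h assume h: "h \<in> ?B - S"
      show "h \<in> (pinned k UNIV H \<inter> ?B) \<union> (?E1 \<union> ?E2)"
      proof (cases "h \<in> inner (2 * int k)")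
        case False
        then show ?thesis using h by (cases h) (auto simp: board_def inner_def)
      next
        case True
        have "h \<in> pinned k ?B (?B - S)"
          using saturated_holes_pinned[OF _ S] h k by simp
        then obtain p d where L: "d \<in> directions" "segment k p d \<subseteq> ?B" "h \<in> segment k p d"
            "card (segment k p d \<inter> (?B - S)) = 2"
          by (auto simp: pinned_def)
        have "segment k p d \<subseteq> inner (int k)"
        proof
          fix r assume r: "r \<in> segment k p d"
          show "r \<in> inner (int k)"
            using segment_near[OF L(3) r L(1)] True
            by (cases r; cases h) (auto simp: inner_def)
        qed
        then have "segment k p d \<inter> H = segment k p d \<inter> (?B - S)"
          using L(2) red_id unfolding H_def C_def by (auto simp: subset_iff simp del: split_paired_All)
        moreover have "h \<in> H"
          using h red_id by (simp add: H_def C_def)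
        ultimately have "h \<in> pinned k UNIV H"
          using L by (intro pinnedI[of _ _ d _ p]) auto
        with h show ?thesis by blast
      qed
    qed
    then have "card (?B - S) \<le> card ((pinned k UNIV H \<inter> ?B) \<union> (?E1 \<union> ?E2))"
      by (intro card_mono) auto
    also have "\<dots> \<le> card (pinned k UNIV H \<inter> ?B) + (card ?E1 + card ?E2)"
      by (meson add_mono card_Un_le le_refl order_trans)
    also have "card ?E1 \<le> (2 * k + 2 * k) * n"
    proof -
      have "card ({1..2 * int k} \<union> {int m - 2 * int k + 1..int m}) \<le> 2 * k + 2 * k"
        by (rule order_trans[OF card_Un_le]) simp
      then show ?thesis by (simp add: card_cartesian_product del: mult_2)
    qed
    also have "card ?E2 \<le> m * (2 * k + 2 * k)"
    proof -
      have "card ({1..2 * int k} \<union> {int n - 2 * int k + 1..int n}) \<le> 2 * k + 2 * k"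
        by (rule order_trans[OF card_Un_le]) simp
      then show ?thesis by (simp add: card_cartesian_product)
    qed
    finally show ?thesis by (simp add: algebra_simps)
  qed
  ultimately show thesis by (rule that)
qed

lemma bdd_above_pattern_densities: "bdd_above (pattern_densities k)"
proof (rule bdd_aboveI[of _ 1])
  fix c assume "c \<in> pattern_densities k"
  then obtain m n H where c: "0 < m" "0 < n"
    "c = real (card (pinned k UNIV H \<inter> board m n)) / (real m * real n)"
    by (auto simp: pattern_densities_def)
  have "card (pinned k UNIV H \<inter> board m n) \<le> m * n"
    by (metis Int_lower2 card_board card_mono finite_board)
  then show "c \<le> 1"
    using c by (simp flip: of_nat_mult)
qed

lemma min_density_ge_patterns:
  assumes "2 \<le> k" "0 < m" "0 < n"
  shows "1 - Sup (pattern_densities k) - 4 * real k * (1 / real m + 1 / real n)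
    \<le> min_density k (board m n)"
proof -
  obtain S where S: "S \<in> saturated k (board m n)"
    "min_density k (board m n) = 1 - real (card (board m n - S)) / (real m * real n)"
    using min_density_attained[OF assms] .
  obtain H where H: "periodic m n H" "design k UNIV H"
    "card (board m n - S) \<le> card (pinned k UNIV H \<inter> board m n) + 4 * k * (m + n)"
    using periodise_saturated[OF assms S(1)] .
  let ?c = "real (card (pinned k UNIV H \<inter> board m n)) / (real m * real n)"
  have "?c \<in> pattern_densities k"
    using assms H by (auto simp: pattern_densities_def)
  then have "?c \<le> Sup (pattern_densities k)"
    by (rule cSup_upper[OF _ bdd_above_pattern_densities])
  moreover have "real (card (board m n - S)) / (real m * real n)
      \<le> real (card (pinned k UNIV H \<inter> board m n) + 4 * k * (m + n)) / (real m * real n)"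
    using H(3) by (intro divide_right_mono) (auto simp only: of_nat_le_iff, simp)
  moreover have "\<dots> = ?c + 4 * real k * (1 / real m + 1 / real n)"
    using assms by (simp add: field_simps)
  ultimately show ?thesis using S(2) by linarith
qed

lemma min_density_le_pattern:
  assumes "0 < k" "0 < m" "0 < n" "periodic m n H" "design k UNIV H" "0 < M" "0 < N"
  shows "min_density k (board M N) \<le>
    1 - real (card (pinned k UNIV H \<inter> board m n)) *
        (real (M div m - 2 * k) / real M) * (real (N div n - 2 * k) / real N)"
proof -
  let ?B = "board M N"
  have "design k ?B (H \<inter> ?B)"
    unfolding design_def
  proof (intro allI ballI impI)
    fix p d assume "d \<in> directions" "segment k p d \<subseteq> ?B"
    moreover from this have "segment k p d \<inter> (H \<inter> ?B) = segment k p d \<inter> H" by blast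
    ultimately show "2 \<le> card (segment k p d \<inter> (H \<inter> ?B))"
      using assms(5) by (simp add: design_def del: split_paired_All)
  qed
  then have "min_density k ?B \<le> 1 - real (card (pinned k ?B (H \<inter> ?B))) / (real M * real N)"
    using assms by (intro min_density_le_pinned) auto
  moreover have "real ((M div m - 2 * k) * (N div n - 2 * k) * card (pinned k UNIV H \<inter> board m n))
      / (real M * real N) \<le> real (card (pinned k ?B (H \<inter> ?B))) / (real M * real N)"
    using card_pinned_board[OF assms(2-4), of M k N] by (intro divide_right_mono) (auto simp only: of_nat_le_iff, simp)
  ultimately show ?thesis by (simp add: mult_ac)
qed

lemma tendsto_div_minus_const:
  assumes "0 < m"
  shows "(\<lambda>M::nat. real (M div m - c) / real M) \<longlonglongrightarrow> 1 / real m"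
proof (rule tendsto_sandwich)
  show "\<forall>\<^sub>F M in sequentially. 1 / real m - (1 + real c) * (1 / real M) \<le> real (M div m - c) / real M"
    using eventually_gt_at_top[of 0]
  proof eventually_elim
    case (elim M)
    have "real M / real m - (1 + real c) \<le> real (M div m - c)"
      using floor_divide_of_nat_eq[of M m, where 'a = real] floor_correct[of "real M / real m"] by linarith
    then have "(real M / real m - (1 + real c)) / real M \<le> real (M div m - c) / real M"
      by (rule divide_right_mono) simp
    then show ?case using elim by (simp add: diff_divide_distrib)
  qed
  show "\<forall>\<^sub>F M in sequentially. real (M div m - c) / real M \<le> 1 / real m"
    using eventually_gt_at_top[of 0]
  proof eventually_elim
    case (elim M)
    have "real (M div m - c) \<le> real M / real m"
      using of_nat_div_le_of_nat[of M m, where 'a = real] by linarith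
    then have "real (M div m - c) / real M \<le> real M / real m / real M"
      by (rule divide_right_mono) simp
    then show ?case using elim by simp
  qed
  have "(\<lambda>M. 1 / real m - (1 + real c) * (1 / real M)) \<longlonglongrightarrow> 1 / real m - (1 + real c) * 0"
    by (intro tendsto_intros lim_1_over_n)
  then show "(\<lambda>M. 1 / real m - (1 + real c) * (1 / real M)) \<longlonglongrightarrow> 1 / real m" by simp
qed auto

text \<open>Periodising any board bounds its density below by the claimed limit up to a boundary term that
  vanishes, while each periodic pattern bounds the densities of large boards above; the supremum
  over patterns closes the gap.\<close>

lemma min_density_tendsto:
  assumes k: "2 \<le> k" and ne: "pattern_densities k \<noteq> {}"
    and M: "filterlim M at_top sequentially" and N: "filterlim N at_top sequentially"
  shows "(\<lambda>t. min_density k (board (M t) (N t))) \<longlonglongrightarrow> 1 - Sup (pattern_densities k)"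
proof -
  let ?L = "Sup (pattern_densities k)"
  have pos: "\<forall>\<^sub>F t in sequentially. 0 < M t" "\<forall>\<^sub>F t in sequentially. 0 < N t"
    using M N by (simp_all add: filterlim_at_top Suc_le_eq[symmetric])
  show ?thesis
  proof (rule order_tendstoI)
    fix a assume a: "a < 1 - ?L"
    have inv: "(\<lambda>t. 1 / real (M t)) \<longlonglongrightarrow> 0" "(\<lambda>t. 1 / real (N t)) \<longlonglongrightarrow> 0"
      using filterlim_compose[OF lim_1_over_n M] filterlim_compose[OF lim_1_over_n N] by auto
    have "(\<lambda>t. 1 - ?L - 4 * real k * (1 / real (M t) + 1 / real (N t)))
        \<longlonglongrightarrow> 1 - ?L - 4 * real k * (0 + 0)"
      by (intro tendsto_intros inv)
    then have "\<forall>\<^sub>F t in sequentially. a < 1 - ?L - 4 * real k * (1 / real (M t) + 1 / real (N t))"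
      using a by (intro order_tendstoD(1)) auto
    with pos show "\<forall>\<^sub>F t in sequentially. a < min_density k (board (M t) (N t))"
      by eventually_elim (use min_density_ge_patterns[OF k] less_le_trans in blast)
  next
    fix a assume "1 - ?L < a"
    then have "1 - a < ?L" by simp
    then obtain c where "c \<in> pattern_densities k" "1 - a < c"
      using less_cSup_iff[OF ne bdd_above_pattern_densities] by blast
    then obtain m n H where mn: "0 < m" "0 < n" "periodic m n H" "design k UNIV H"
      and c: "1 - a < real (card (pinned k UNIV H \<inter> board m n)) / (real m * real n)"
      by (auto simp: pattern_densities_def)
    let ?g = "real (card (pinned k UNIV H \<inter> board m n))"
    have "(\<lambda>t. 1 - ?g * (real (M t div m - 2 * k) / real (M t)) * (real (N t div n - 2 * k) / real (N t)))
        \<longlonglongrightarrow> 1 - ?g * (1 / real m) * (1 / real n)"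
      by (intro tendsto_intros filterlim_compose[OF tendsto_div_minus_const M]
          filterlim_compose[OF tendsto_div_minus_const N] mn)
    then have "\<forall>\<^sub>F t in sequentially.
        1 - ?g * (real (M t div m - 2 * k) / real (M t)) * (real (N t div n - 2 * k) / real (N t)) < a"
      using c by (intro order_tendstoD(2)) auto
    with pos show "\<forall>\<^sub>F t in sequentially. min_density k (board (M t) (N t)) < a"
      by eventually_elim
         (use min_density_le_pattern[OF _ mn] k in \<open>auto intro: le_less_trans\<close>)
  qed
qed

lemma plane_density_eq:
  assumes "2 \<le> k" "pattern_densities k \<noteq> {}"
  shows "plane_density k = 1 - Sup (pattern_densities k)"
  unfolding plane_density_def
proof (rule the_equality)
  show "\<forall>m n. filterlim m at_top sequentially \<longrightarrow> filterlim n at_top sequentially \<longrightarrow>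
      (\<lambda>t. min_density k (board (m t) (n t))) \<longlonglongrightarrow> 1 - Sup (pattern_densities k)"
    using min_density_tendsto[OF assms] by blast
next
  fix l
  assume "\<forall>m n. filterlim m at_top sequentially \<longrightarrow> filterlim n at_top sequentially \<longrightarrow>
      (\<lambda>t. min_density k (board (m t) (n t))) \<longlonglongrightarrow> l"
  then have "(\<lambda>t. min_density k (board t t)) \<longlonglongrightarrow> l"
    using filterlim_ident by blast
  moreover have "(\<lambda>t. min_density k (board t t)) \<longlonglongrightarrow> 1 - Sup (pattern_densities k)"
    by (intro min_density_tendsto[OF assms] filterlim_ident)
  ultimately show "l = 1 - Sup (pattern_densities k)"
    by (rule LIMSEQ_unique)
qed

lemma plane_density_ge:
  assumes k: "2 \<le> k" and ne: "pattern_densities k \<noteq> {}"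
  shows "1 - 16 / real k \<le> plane_density k"
proof (rule LIMSEQ_le)
  show "(\<lambda>t. min_density k (board t t)) \<longlonglongrightarrow> plane_density k"
    unfolding plane_density_eq[OF assms] by (intro min_density_tendsto[OF assms] filterlim_ident)
  have "(\<lambda>t. 1 - 16 * ((1 / real k + 1 / real t) * (1 + 2 * real k * (1 / real t))))
      \<longlonglongrightarrow> 1 - 16 * ((1 / real k + 0) * (1 + 2 * real k * 0))"
    by (intro tendsto_intros lim_1_over_n)
  then show "(\<lambda>t. 1 - 16 * ((1 / real k + 1 / real t) * (1 + 2 * real k * (1 / real t))))
      \<longlonglongrightarrow> 1 - 16 / real k"
    by simp
  have "1 - 16 * ((1 / real k + 1 / real t) * (1 + 2 * real k * (1 / real t)))
      \<le> min_density k (board t t)" if t: "1 \<le> t" for t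
  proof -
    obtain S where S: "S \<in> saturated k (board t t)"
      "min_density k (board t t) = 1 - real (card (board t t - S)) / (real t * real t)"
      using min_density_attained[OF k] t by (metis less_eq_Suc_le One_nat_def)
    have "card (board t t - S) \<le> 16 * ((t div k + 1) * (t + 2 * k))"
      using card_saturated_holes[OF _ S(1)] k by simp
    then have "real (card (board t t - S)) \<le> 16 * ((real (t div k) + 1) * (real t + 2 * real k))"
      by (simp only: flip: of_nat_le_iff[where 'a = real]) (simp add: algebra_simps)
    also have "\<dots> \<le> 16 * ((real t / real k + 1) * (real t + 2 * real k))"
      using of_nat_div_le_of_nat[of t k, where 'a = real] by (intro mult_left_mono mult_right_mono) auto
    finally have "real (card (board t t - S)) / (real t * real t)
        \<le> 16 * ((real t / real k + 1) * (real t + 2 * real k)) / (real t * real t)"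
      by (rule divide_right_mono) simp
    also have "\<dots> = 16 * ((1 / real k + 1 / real t) * (1 + 2 * real k * (1 / real t)))"
      using t k by (simp add: field_simps)
    finally show ?thesis using S(2) by linarith
  qed
  then show "\<exists>T. \<forall>t\<ge>T. 1 - 16 * ((1 / real k + 1 / real t) * (1 + 2 * real k * (1 / real t)))
      \<le> min_density k (board t t)"
    by blast
qed

section \<open>A grid of double lines\<close>

definition grid :: "nat \<Rightarrow> (int \<times> int) set" where
  "grid D = {(x, y). x mod int D \<in> {0, 1} \<or> y mod int D \<in> {0, 1}}"

lemma periodic_grid: "periodic D D (grid D)"
  by (simp add: periodic_def grid_def)

text \<open>In every direction at least one coordinate moves by unit steps, so it runs through a full residue
  system modulo \<open>D\<close> and meets both residues \<open>0\<close> and \<open>1\<close>.\<close>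

lemma design_grid:
  assumes D: "2 \<le> D" "D \<le> k"
  shows "design k UNIV (grid D)"
  unfolding design_def
proof (intro allI ballI impI)
  fix p d assume d: "d \<in> directions"
  have hits: "\<exists>j<k. (a + int j * e) mod int D = r" if "e = 1 \<or> e = -1" "r = 0 \<or> r = 1" for a e r :: int
  proof -
    have "0 \<le> ((r - a) * e) mod int D" "((r - a) * e) mod int D < int D"
      using D by auto
    then obtain j where j: "int j = ((r - a) * e) mod int D" "j < D"
      by (metis nonneg_int_cases of_nat_less_iff)
    have "(a + int j * e) mod int D = (a + (r - a) * e * e) mod int D"
      unfolding j(1) by (metis mod_add_right_eq mod_mult_left_eq)
    also have "a + (r - a) * e * e = r" using that(1) by auto
    also have "r mod int D = r" using that(2) D by auto
    finally have "(a + int j * e) mod int D = r" .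
    moreover have "j < k" using j(2) D by simp
    ultimately show ?thesis by blast
  qed
  obtain u v where uv: "u \<in> segment k p d" "v \<in> segment k p d" "u \<in> grid D" "v \<in> grid D" "u \<noteq> v"
  proof (cases "fst d = 0")
    case False
    then have "fst d = 1 \<or> fst d = -1" using d by (auto simp: directions_cases)
    then obtain i j where ij: "i < k" "(fst p + int i * fst d) mod int D = 0"
        "j < k" "(fst p + int j * fst d) mod int D = 1"
      using hits by metis
    show thesis
      by (rule that[of "(fst p + int i * fst d, snd p + int i * snd d)"
            "(fst p + int j * fst d, snd p + int j * snd d)"])
         (use ij in \<open>auto simp: mem_segment grid_def\<close>)
  next
    case True
    then have "snd d = 1 \<or> snd d = -1" using d by (auto simp: directions_cases)
    then obtain i j where ij: "i < k" "(snd p + int i * snd d) mod int D = 0"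
        "j < k" "(snd p + int j * snd d) mod int D = 1"
      using hits by metis
    show thesis
      by (rule that[of "(fst p + int i * fst d, snd p + int i * snd d)"
            "(fst p + int j * fst d, snd p + int j * snd d)"])
         (use ij in \<open>auto simp: mem_segment grid_def\<close>)
  qed
  then have "card {u, v} \<le> card (segment k p d \<inter> grid D)"
    by (intro card_mono) auto
  with uv(5) show "2 \<le> card (segment k p d \<inter> grid D)" by simp
qed

text \<open>The longest interval meeting only one pair \<open>{b, b + 1}\<close> of marked residues runs from just after
  the preceding pair to just before the next one, and has \<open>2 D - 2\<close> elements. This is what forces
  \<open>D\<close> to be at least about \<open>k / 2\<close>.\<close>

lemma double_line_window:
  assumes D: "2 \<le> D" "D \<le> k" "k \<le> 2 * D - 2" and a: "a mod int D \<in> {0, 1}"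
  obtains s where "s \<le> a" "a < s + int k"
    "card ({s..<s + int k} \<inter> {t. t mod int D \<in> {0, 1}}) = 2"
proof -
  define b where "b = a - a mod int D"
  have b: "b = int D * (a div int D)" by (simp add: b_def minus_mod_eq_mult_div)
  \<comment> \<open>the first point after the preceding pair \<open>b - D, b - D + 1\<close>\<close>
  define s where "s = b + 2 - int D"
  have res: "(b + t) mod int D = t" "(b - int D + t) mod int D = t" if "0 \<le> t" "t < int D" for t
  proof -
    show "(b + t) mod int D = t" using that by (simp add: b)
    have "b - int D + t = int D * (a div int D - 1) + t" by (simp add: b algebra_simps)
    then show "(b - int D + t) mod int D = t" using that by simp
  qed
  have "{s..<s + int k} \<inter> {t. t mod int D \<in> {0, 1}} = {b, b + 1}"
  proof (intro equalityI subsetI)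
    fix t assume t: "t \<in> {s..<s + int k} \<inter> {t. t mod int D \<in> {0, 1}}"
    show "t \<in> {b, b + 1}"
    proof (cases "t < b")
      case True
      then have "(b - int D + (t - b + int D)) mod int D = t - b + int D"
        using t by (intro res) (auto simp: s_def)
      then have "t mod int D = t - b + int D" by simp
      then show ?thesis using t by (auto simp: s_def)
    next
      case False
      then have "(b + (t - b)) mod int D = t - b"
        using t D by (intro res) (auto simp: s_def)
      then have "t mod int D = t - b" by simp
      then show ?thesis using t by auto
    qed
  next
    fix t assume "t \<in> {b, b + 1}"
    then show "t \<in> {s..<s + int k} \<inter> {t. t mod int D \<in> {0, 1}}"
      using res(1)[of 0] res(1)[of 1] D by (auto simp: s_def)
  qed
  then show thesis
    using that[of s] a D by (auto simp: s_def b_def)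
qed

lemma pinned_grid:
  assumes D: "2 \<le> D" "D \<le> k" "k \<le> 2 * D - 2"
    and a: "a mod int D \<in> {0, 1}" and c: "c mod int D \<notin> {0, 1}"
  shows "(a, c) \<in> pinned k UNIV (grid D)" "(c, a) \<in> pinned k UNIV (grid D)"
proof -
  let ?R = "{t. t mod int D \<in> {0, 1}}"
  obtain s where s: "s \<le> a" "a < s + int k" "card ({s..<s + int k} \<inter> ?R) = 2"
    using double_line_window[OF D a] .
  have window: "(\<lambda>j. s + int j) ` {..<k} = {s..<s + int k}"
  proof (intro equalityI subsetI)
    fix t assume "t \<in> {s..<s + int k}"
    then show "t \<in> (\<lambda>j. s + int j) ` {..<k}"
      by (intro image_eqI[of _ _ "nat (t - s)"]) auto
  qed auto
  have h: "segment k (s, c) (1, 0) = (\<lambda>t. (t, c)) ` {s..<s + int k}"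
    and v: "segment k (c, s) (0, 1) = (\<lambda>t. (c, t)) ` {s..<s + int k}"
    by (simp_all add: segment_def image_image flip: window)
  have "segment k (s, c) (1, 0) \<inter> grid D = (\<lambda>t. (t, c)) ` ({s..<s + int k} \<inter> ?R)"
    "segment k (c, s) (0, 1) \<inter> grid D = (\<lambda>t. (c, t)) ` ({s..<s + int k} \<inter> ?R)"
    unfolding h v using c by (auto simp: grid_def)
  then have "card (segment k (s, c) (1, 0) \<inter> grid D) = 2"
    "card (segment k (c, s) (0, 1) \<inter> grid D) = 2"
    using s(3) by (simp_all add: card_image inj_on_def)
  moreover have "(a, c) \<in> segment k (s, c) (1, 0)" "(c, a) \<in> segment k (c, s) (0, 1)"
    unfolding h v using s by auto
  moreover have "(a, c) \<in> grid D" "(c, a) \<in> grid D"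
    using a by (auto simp: grid_def)
  moreover have "(1, 0) \<in> directions" "(0, 1) \<in> directions"
    by (simp_all add: directions_cases)
  ultimately show "(a, c) \<in> pinned k UNIV (grid D)" "(c, a) \<in> pinned k UNIV (grid D)"
    by (metis pinnedI subset_UNIV)+
qed

lemma card_pinned_grid:
  assumes D: "2 \<le> D" "D \<le> k" "k \<le> 2 * D - 2"
  shows "4 * (D - 2) \<le> card (pinned k UNIV (grid D) \<inter> board D D)"
proof -
  let ?A = "{1, int D} \<times> {2..int D - 1}" and ?B = "{2..int D - 1} \<times> {1, int D}"
  have "a mod int D \<in> {0, 1}" if "a \<in> {1, int D}" for a
    using that D by auto
  moreover have "c mod int D \<notin> {0, 1}" if "c \<in> {2..int D - 1}" for c
    using that by auto
  ultimately have "?A \<union> ?B \<subseteq> pinned k UNIV (grid D) \<inter> board D D"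
    using pinned_grid[OF D] D by (auto simp: board_def)
  then have "card (?A \<union> ?B) \<le> card (pinned k UNIV (grid D) \<inter> board D D)"
    by (intro card_mono) auto
  moreover have "card (?A \<union> ?B) = card ?A + card ?B"
    by (rule card_Un_disjoint) auto
  moreover have "card ?A = 2 * (D - 2)" "card ?B = 2 * (D - 2)"
    using D by (auto simp: card_cartesian_product nat_diff_distrib)
  ultimately show ?thesis by simp
qed

text \<open>The period is the least \<open>D\<close> with \<open>k \<le> 2 D - 2\<close>; the bound is \<open>4 (D - 2) / D\<^sup>2\<close> with \<open>2 D\<close>
  estimated by \<open>k + 2\<close> from below and by \<open>k + 3\<close> from above.\<close>

lemma pattern_densities_grid:
  assumes k: "2 \<le> k"
  obtains c where "c \<in> pattern_densities k"
    "8 * (real k - 2) / (real k + 3)\<^sup>2 \<le> c"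
proof -
  define D where "D = (k + 3) div 2"
  have D: "2 \<le> D" "D \<le> k" "k \<le> 2 * D - 2" "2 * D \<le> k + 3" "k + 2 \<le> 2 * D"
    using k by (auto simp: D_def)
  let ?c = "real (card (pinned k UNIV (grid D) \<inter> board D D)) / (real D * real D)"
  have "0 < D" using D by simp
  then have mem: "?c \<in> pattern_densities k"
    unfolding pattern_densities_def using periodic_grid design_grid[OF D(1,2)] by blast
  have "8 * (real k - 2) \<le> 4 * real (4 * (D - 2))"
    using D by (simp add: of_nat_diff)
  also have "\<dots> \<le> 4 * real (card (pinned k UNIV (grid D) \<inter> board D D))"
    using card_pinned_grid[OF D(1-3)] by (simp only: of_nat_le_iff mult_le_cancel_left_pos zero_less_numeral)
  finally have "8 * (real k - 2) / (real k + 3)\<^sup>2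
      \<le> 4 * real (card (pinned k UNIV (grid D) \<inter> board D D)) / (2 * real D)\<^sup>2"
    using D by (intro frac_le power_mono) auto
  also have "\<dots> = ?c"
    by (simp add: power2_eq_square)
  finally have "8 * (real k - 2) / (real k + 3)\<^sup>2 \<le> ?c" .
  with mem that show thesis by blast
qed

theorem mainTheorem3:
  shows "\<exists>f g :: nat \<Rightarrow> real.
    (\<lambda>k. real k * f k) \<longlonglongrightarrow> 0 \<and> (\<lambda>k. real k * g k) \<longlonglongrightarrow> 0 \<and>
    (\<forall>\<^sub>F k in sequentially.
       1 - 16 / real k - f k \<le> plane_density k \<and>
       plane_density k \<le> 1 - 8 / real k + g k)"
proof (intro exI conjI)
  let ?g = "\<lambda>k::nat. 8 / real k - 8 * (real k - 2) / (real k + 3)\<^sup>2"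
  show "(\<lambda>k. real k * (\<lambda>_. 0) k) \<longlonglongrightarrow> 0" by simp
  show "(\<lambda>k. real k * ?g k) \<longlonglongrightarrow> 0" by real_asymp
  show "\<forall>\<^sub>F k in sequentially. 1 - 16 / real k - (\<lambda>_. 0) k \<le> plane_density k \<and>
       plane_density k \<le> 1 - 8 / real k + ?g k"
    using eventually_ge_at_top[of 2]
  proof eventually_elim
    case (elim k)
    obtain c where c: "c \<in> pattern_densities k"
      "8 * (real k - 2) / (real k + 3)\<^sup>2 \<le> c"
      using pattern_densities_grid[OF elim] .
    then have ne: "pattern_densities k \<noteq> {}" by blast
    have "c \<le> Sup (pattern_densities k)"
      by (rule cSup_upper[OF c(1) bdd_above_pattern_densities])
    then show ?case
      using plane_density_ge[OF elim ne] plane_density_eq[OF elim ne] c(2) by simp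
  qed
qed

end
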